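(* Let $(H;\langle\cdot,\cdot\rangle)$ be a Hilbert space over the real or complex number field $\mathbb{K}$, let $[a,b]$ be a compact interval in $\mathbb{R}$, and let $\eta:[a,b]\to[0,\infty)$ be a Lebesgue integrable function with $\int_a^b\eta(t)\,dt=1$. Let $g\in L_\eta([a,b];H)$ be such that $\int_a^b\eta(t)\|g(t)\|^2dt=1$, let $f_i\in L_\eta([a,b];H)$ for $i\in\{1,\dots,n\}$, and let $M\ge m>0$ be such that either $$\operatorname{Re}\langle Mf_j(t)-f_i(t),\,f_i(t)-mf_j(t)\rangle\ge0$$ or, equivalently, $$\Big\|f_i(t)-\frac{m+M}{2}f_j(t)\Big\|\le\frac12(M-m)\|f_j(t)\|$$ for a.e. $t\in[a,b]$ and all $1\le i<j\le n$. Then $$\frac{2\sqrt{mM}}{m+M}\Big[\sum_{i=1}^n\Big(\int_a^b\eta(t)\|f_i(t)\|^2dt\Big)^{1/2}\Big]^2+\frac{(\sqrt M-\sqrt m)^2}{m+M}\sum_{i=1}^n\int_a^b\eta(t)\|f_i(t)\|^2dt\le\int_a^b\eta(t)\Big\|\sum_{i=1}^n f_i(t)\Big\|^2dt.$$ Equality holds in this last inequality if and only if $$\Big(\int_a^b\eta(t)\|f_i(t)\|^2dt\Big)^{1/2}\Big(\int_a^b\eta(t)\|f_j(t)\|^2dt\Big)^{1/2}=\frac{M+m}{2\sqrt{mM}}\int_a^b\eta(t)\operatorname{Re}\langle f_i(t),f_j(t)\rangle dt$$ for all $i,j$ with $1\le i<j\le n$.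
   Context: $n$ is a positive integer and $\|\cdot\|$ is the norm on $H$ induced by its inner product. $L_\eta([a,b];H)$ denotes the Hilbert space of all Bochner measurable functions $f:[a,b]\to H$ with $\int_a^b\eta(t)\|f(t)\|^2dt<\infty$, with inner product $\langle f,g\rangle_\eta:=\int_a^b\eta(t)\langle f(t),g(t)\rangle dt$. *)

theory Defs
  imports "HOL-Analysis.Analysis"
begin

text \<open>
  A Hilbert space over \<open>K\<close>, where \<open>K\<close> is the real or the complex number field, the former
  regarded as the subfield \<open>\<real>\<close> of the complex numbers. The values of \<open>scale\<close> at scalars
  outside \<open>K\<close> are irrelevant. Completeness and definiteness of the inner product come from
  the type classes, whose norm is required to be the one induced by \<open>ip\<close>. The inner
  product is linear in its first argument.
\<close>

locale hilbert_space_over =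
  fixes K :: "complex set"
    and scale :: "complex \<Rightarrow> 'h::{real_normed_vector,complete_space} \<Rightarrow> 'h"
    and ip :: "'h \<Rightarrow> 'h \<Rightarrow> complex"
  assumes scalar_field: "K = \<real> \<or> K = UNIV"
    and scale_of_real: "scale (complex_of_real r) x = r *\<^sub>R x"
    and scale_add_right: "c \<in> K \<Longrightarrow> scale c (x + y) = scale c x + scale c y"
    and scale_add_left: "c \<in> K \<Longrightarrow> d \<in> K \<Longrightarrow> scale (c + d) x = scale c x + scale d x"
    and scale_scale: "c \<in> K \<Longrightarrow> d \<in> K \<Longrightarrow> scale c (scale d x) = scale (c * d) x"
    and ip_in_scalars: "ip x y \<in> K"
    and ip_commute: "ip y x = cnj (ip x y)"
    and ip_add_left: "ip (x + y) z = ip x z + ip y z"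
    and ip_scale_left: "c \<in> K \<Longrightarrow> ip (scale c x) y = c * ip x y"
    and ip_self: "ip x x = complex_of_real ((norm x)\<^sup>2)"

lemma hilbert_space_over_Reals:
  "hilbert_space_over \<real> (\<lambda>c x. Re c *\<^sub>R x)
     (\<lambda>x y. complex_of_real (inner x (y::'h::{real_inner,complete_space})))"
  by unfold_locales
    (auto simp: scaleR_add_right scaleR_add_left inner_commute inner_add_left inner_add_right
      power2_norm_eq_inner elim!: Reals_cases)

lemma hilbert_space_over_complex:
  "hilbert_space_over UNIV (*) (\<lambda>z w. z * cnj w)"
  by unfold_locales
    (auto simp: scaleR_conv_of_real algebra_simps complex_norm_square[symmetric])

text \<open>
  Strong measurability. The library's \<open>borel_measurable\<close> coincides with it (up to null sets)
  only for essentially separably valued functions, and the Hilbert space need not be separable.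
\<close>

definition bochner_measurable :: "'a measure \<Rightarrow> ('a \<Rightarrow> 'b::real_normed_vector) \<Rightarrow> bool" where
  "bochner_measurable M f \<longleftrightarrow>
     (\<exists>s. (\<forall>k. simple_function M (s k)) \<and> (AE x in M. (\<lambda>k. s k x) \<longlonglongrightarrow> f x))"

text \<open>
  Elements are represented by functions on the whole real line; only their values on the
  interval matter, and functions equal almost everywhere are not identified.
\<close>

definition L_weighted :: "(real \<Rightarrow> real) \<Rightarrow> real \<Rightarrow> real \<Rightarrow> (real \<Rightarrow> 'h::real_normed_vector) set" where
  "L_weighted \<eta> a b =
     {f. bochner_measurable (lebesgue_on {a..b}) f \<and>
         integrable (lebesgue_on {a..b}) (\<lambda>t. \<eta> t * (norm (f t))\<^sup>2)}"

end

theory Submission imports Defs begin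

text \<open>
  Write \<open>\<langle>u, v\<rangle>\<close> for the real part of the weighted inner product of \<open>L\<^sub>\<eta>\<close>, write
  \<open>N\<^sub>i\<close> for the norm of \<open>f\<^sub>i\<close> there, and put \<open>c = 2 \<surd>(mM) / (m + M)\<close>.

  The pointwise hypothesis on a pair \<open>i < j\<close>, multiplied out, says
  \<open>\<parallel>f\<^sub>i(t)\<parallel>\<^sup>2 + mM \<parallel>f\<^sub>j(t)\<parallel>\<^sup>2 \<le> (m + M) Re \<langle>f\<^sub>i(t), f\<^sub>j(t)\<rangle>\<close>. This is linear in the three quadratic
  quantities, so it survives integration against \<open>\<eta>\<close>, and the inequality of the arithmetic and
  geometric means applied to the left-hand side turns it into a reverse Cauchy--Schwarz inequality
  \<open>c N\<^sub>i N\<^sub>j \<le> \<langle>f\<^sub>i, f\<^sub>j\<rangle>\<close> (lemmas \<open>Re_ip_accretive\<close> and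
  \<open>reverse_Cauchy_Schwarz_weighted\<close>).

  The claim is the sum of these over all pairs. Since \<open>(\<surd>M - \<surd>m)\<^sup>2 / (m + M) = 1 - c\<close>, the lower
  bound is the double sum over \<open>i\<close> and \<open>j\<close> of \<open>c N\<^sub>i N\<^sub>j\<close> off the diagonal and of \<open>N\<^sub>i\<^sup>2\<close> on it,
  while the squared norm of the sum is the double sum of \<open>\<langle>f\<^sub>i, f\<^sub>j\<rangle>\<close>. The two agree on the
  diagonal, and off it they compare entry by entry; a sum of nonnegative differences vanishes only
  if every difference does, which is the equality case (lemma \<open>gram_sum_lower_bound\<close>).

  What remains is to see that all integrals exist. The inner product of two Bochner measurable
  functions is almost everywhere a limit of simple functions, hence measurable because Lebesgue
  measure is complete (lemma \<open>bochner_measurable_compose2\<close>), and it is dominated by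
  \<open>2 \<bar>Re \<langle>x, y\<rangle>\<bar> \<le> \<parallel>x\<parallel>\<^sup>2 + \<parallel>y\<parallel>\<^sup>2\<close>.
\<close>

section \<open>Measurability of functions of Bochner measurable functions\<close>

lemma (in complete_measure) borel_measurable_AE_LIMSEQ_real:
  fixes u :: "nat \<Rightarrow> 'a \<Rightarrow> real"
  assumes u: "\<And>k. u k \<in> borel_measurable M"
    and lim: "AE x in M. (\<lambda>k. u k x) \<longlonglongrightarrow> v x"
  shows "v \<in> borel_measurable M"
proof -
  define A where "A = {x \<in> space M. (\<lambda>k. u k x) \<longlonglongrightarrow> v x}"
  have "A \<in> sets M"
    by (rule in_sets_AE[of "space M"]) (use lim in \<open>auto simp: A_def\<close>)
  have v': "(\<lambda>x. indicator A x * v x) \<in> borel_measurable M"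
  proof (rule borel_measurable_LIMSEQ_real)
    show "(\<lambda>k. indicator A x * u k x) \<longlonglongrightarrow> indicator A x * v x" for x
      by (auto simp: A_def indicator_def)
    show "(\<lambda>x. indicator A x * u k x) \<in> borel_measurable M" for k
      using u \<open>A \<in> sets M\<close> by measurable
  qed
  have AE_A: "AE x in M. x \<in> A"
    using lim by (auto simp: A_def)
  show ?thesis
    unfolding borel_measurable_iff_le
  proof
    fix r
    show "{x \<in> space M. v x \<le> r} \<in> sets M"
    proof (rule in_sets_AE)
      show "{x \<in> space M. indicator A x * v x \<le> r} \<in> sets M"
        using v' by measurable
      show "AE x in M. x \<in> {x \<in> space M. indicator A x * v x \<le> r} \<longleftrightarrow>
          x \<in> {x \<in> space M. v x \<le> r}"
        using AE_A by eventually_elim auto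
    qed auto
  qed
qed

text \<open>
  In a non-separable space, Borel measurability of \<open>f\<close> and of \<open>g\<close> would not yield that of the
  pair \<open>(f, g)\<close>. Therefore \<open>h\<close> is applied to the approximating simple functions, which take only
  finitely many pairs of values.
\<close>

lemma (in complete_measure) bochner_measurable_compose2:
  fixes h :: "'b::real_normed_vector \<Rightarrow> 'c::real_normed_vector \<Rightarrow> real"
  assumes f: "bochner_measurable M f" and g: "bochner_measurable M g"
    and h: "\<And>X Y x y. X \<longlonglongrightarrow> x \<Longrightarrow> Y \<longlonglongrightarrow> y \<Longrightarrow> (\<lambda>k. h (X k) (Y k)) \<longlonglongrightarrow> h x y"
  shows "(\<lambda>x. h (f x) (g x)) \<in> borel_measurable M"
proof -
  obtain s where s: "\<And>k. simple_function M (s k)" "AE x in M. (\<lambda>k. s k x) \<longlonglongrightarrow> f x"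
    using f unfolding bochner_measurable_def by blast
  obtain s' where s': "\<And>k. simple_function M (s' k)" "AE x in M. (\<lambda>k. s' k x) \<longlonglongrightarrow> g x"
    using g unfolding bochner_measurable_def by blast
  show ?thesis
  proof (rule borel_measurable_AE_LIMSEQ_real)
    show "(\<lambda>x. h (s k x) (s' k x)) \<in> borel_measurable M" for k
      by (rule borel_measurable_simple_function[OF simple_function_compose2[OF s(1) s'(1)]])
    show "AE x in M. (\<lambda>k. h (s k x) (s' k x)) \<longlonglongrightarrow> h (f x) (g x)"
      using s(2) s'(2) by eventually_elim (rule h)
  qed
qed

lemma complete_measure_lebesgue_on:
  assumes "S \<in> sets lebesgue"
  shows "complete_measure (lebesgue_on S)"
proof
  fix A B :: "'a set"
  assume "B \<subseteq> A" "A \<in> null_sets (lebesgue_on S)"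
  then have "B \<subseteq> S" "B \<in> sets lebesgue"
    using assms completion.complete2[of B A lborel] by (auto simp: null_sets_restrict_space)
  then show "B \<in> sets (lebesgue_on S)"
    using assms by (simp add: sets_restrict_space_iff)
qed

section \<open>The real part of the inner product\<close>

context hilbert_space_over
begin

lemma Re_ip_commute: "Re (ip x y) = Re (ip y x)"
  by (subst ip_commute) simp

lemma Re_ip_self: "Re (ip x x) = (norm x)\<^sup>2"
  by (simp add: ip_self)

lemma Re_ip_add_left: "Re (ip (x + y) z) = Re (ip x z) + Re (ip y z)"
  by (simp add: ip_add_left)

lemma Re_ip_add_right: "Re (ip z (x + y)) = Re (ip z x) + Re (ip z y)"
  using Re_ip_add_left Re_ip_commute by metis

lemma Re_ip_scaleR_left: "Re (ip (r *\<^sub>R x) y) = r * Re (ip x y)"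
proof -
  have "complex_of_real r \<in> K"
    using scalar_field by auto
  then show ?thesis
    using ip_scale_left[of "complex_of_real r" x y] by (simp add: scale_of_real)
qed

lemma Re_ip_scaleR_right: "Re (ip x (r *\<^sub>R y)) = r * Re (ip x y)"
  using Re_ip_scaleR_left Re_ip_commute by metis

lemma Re_ip_diff_left: "Re (ip (x - y) z) = Re (ip x z) - Re (ip y z)"
  using Re_ip_add_left[of x "(-1) *\<^sub>R y" z] Re_ip_scaleR_left[of "-1" y z] by simp

lemma Re_ip_diff_right: "Re (ip z (x - y)) = Re (ip z x) - Re (ip z y)"
  using Re_ip_diff_left Re_ip_commute by metis

lemmas Re_ip_bilinear = Re_ip_add_left Re_ip_add_right Re_ip_diff_left Re_ip_diff_right
  Re_ip_scaleR_left Re_ip_scaleR_right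

lemma Re_ip_sum_left: "Re (ip (\<Sum>i\<in>I. x i) y) = (\<Sum>i\<in>I. Re (ip (x i) y))"
proof -
  have "Re (ip 0 y) = 0"
    using Re_ip_scaleR_left[of 0 0 y] by simp
  then show ?thesis
    by (induction I rule: infinite_finite_induct) (simp_all add: Re_ip_add_left)
qed

lemma Re_ip_sum_right: "Re (ip y (\<Sum>i\<in>I. x i)) = (\<Sum>i\<in>I. Re (ip y (x i)))"
  unfolding Re_ip_commute[of y] by (rule Re_ip_sum_left)

lemma norm_sum_squared:
  "(norm (\<Sum>i\<in>I. x i))\<^sup>2 = (\<Sum>i\<in>I. \<Sum>j\<in>I. Re (ip (x i) (x j)))"
  unfolding Re_ip_self[symmetric] unfolding Re_ip_sum_left unfolding Re_ip_sum_right ..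

text \<open>Unlike the inner product, the right-hand side is visibly continuous.\<close>

lemma Re_ip_polarization: "Re (ip x y) = ((norm (x + y))\<^sup>2 - (norm (x - y))\<^sup>2) / 4"
  unfolding Re_ip_self[symmetric] unfolding Re_ip_bilinear using Re_ip_commute[of x y] by simp

lemma tendsto_Re_ip:
  assumes "(X \<longlongrightarrow> x) F" "(Y \<longlongrightarrow> y) F"
  shows "((\<lambda>k. Re (ip (X k) (Y k))) \<longlongrightarrow> Re (ip x y)) F"
  unfolding Re_ip_polarization using assms by (intro tendsto_intros) auto

lemma abs_Re_ip_le: "\<bar>Re (ip x y)\<bar> \<le> ((norm x)\<^sup>2 + (norm y)\<^sup>2) / 2"
proof -
  have "0 \<le> Re (ip (x + y) (x + y))" "0 \<le> Re (ip (x - y) (x - y))"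
    by (simp_all only: Re_ip_self zero_le_power2)
  then have "0 \<le> (norm x)\<^sup>2 + (norm y)\<^sup>2 + 2 * Re (ip x y)"
    "0 \<le> (norm x)\<^sup>2 + (norm y)\<^sup>2 - 2 * Re (ip x y)"
    unfolding Re_ip_bilinear unfolding Re_ip_self Re_ip_commute[of y x]
    by (simp_all add: algebra_simps)
  then show ?thesis
    by argo
qed

text \<open>
  The two forms of the pointwise hypothesis both reduce to the same scalar inequality, this one by
  expanding the inner product and the next one by squaring first; hence they are equivalent.
\<close>

lemma Re_ip_accretive:
  "0 \<le> Re (ip (M *\<^sub>R y - x) (x - m *\<^sub>R y)) \<longleftrightarrow>
    (norm x)\<^sup>2 + m * M * (norm y)\<^sup>2 \<le> (m + M) * Re (ip x y)"
  unfolding Re_ip_bilinear unfolding Re_ip_self using Re_ip_commute[of x y]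
  by (simp add: algebra_simps)

lemma norm_diff_midpoint_le_iff:
  assumes "m \<le> M"
  shows "norm (x - ((m + M) / 2) *\<^sub>R y) \<le> 1 / 2 * (M - m) * norm y \<longleftrightarrow>
    (norm x)\<^sup>2 + m * M * (norm y)\<^sup>2 \<le> (m + M) * Re (ip x y)"
proof -
  have "norm (x - ((m + M) / 2) *\<^sub>R y) \<le> 1 / 2 * (M - m) * norm y \<longleftrightarrow>
      (norm (x - ((m + M) / 2) *\<^sub>R y))\<^sup>2 \<le> (1 / 2 * (M - m) * norm y)\<^sup>2"
    using assms by (intro power_mono_iff[symmetric]) auto
  also have "(norm (x - ((m + M) / 2) *\<^sub>R y))\<^sup>2 =
      (norm x)\<^sup>2 - (m + M) * Re (ip x y) + ((m + M) / 2)\<^sup>2 * (norm y)\<^sup>2"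
    unfolding Re_ip_self[symmetric] unfolding Re_ip_bilinear using Re_ip_commute[of x y]
    by (simp add: field_simps power2_eq_square)
  also have "(1 / 2 * (M - m) * norm y)\<^sup>2 = ((m + M) / 2)\<^sup>2 * (norm y)\<^sup>2 - m * M * (norm y)\<^sup>2"
    by (simp add: power2_eq_square field_simps)
  finally show ?thesis
    by linarith
qed

lemma integrable_weighted_Re_ip:
  assumes "complete_measure N"
    and w: "w \<in> borel_measurable N" "\<And>t. t \<in> space N \<Longrightarrow> 0 \<le> w t"
    and f: "bochner_measurable N f" "integrable N (\<lambda>t. w t * (norm (f t))\<^sup>2)"
    and g: "bochner_measurable N g" "integrable N (\<lambda>t. w t * (norm (g t))\<^sup>2)"
  shows "integrable N (\<lambda>t. w t * Re (ip (f t) (g t)))"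
proof (rule Bochner_Integration.integrable_bound)
  show "integrable N (\<lambda>t. (w t * (norm (f t))\<^sup>2 + w t * (norm (g t))\<^sup>2) / 2)"
    using f(2) g(2) by simp
  have "(\<lambda>t. Re (ip (f t) (g t))) \<in> borel_measurable N"
    by (rule complete_measure.bochner_measurable_compose2[OF assms(1) f(1) g(1)])
      (rule tendsto_Re_ip)
  then show "(\<lambda>t. w t * Re (ip (f t) (g t))) \<in> borel_measurable N"
    using w(1) by measurable
  have "norm (w t * Re (ip (f t) (g t))) \<le> norm ((w t * (norm (f t))\<^sup>2 + w t * (norm (g t))\<^sup>2) / 2)"
    if "t \<in> space N" for t
  proof -
    have "w t * \<bar>Re (ip (f t) (g t))\<bar> \<le> w t * (((norm (f t))\<^sup>2 + (norm (g t))\<^sup>2) / 2)"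
      using w(2)[OF that] abs_Re_ip_le by (intro mult_left_mono) auto
    then show ?thesis
      using w(2)[OF that] by (simp add: abs_mult distrib_left)
  qed
  then show "AE t in N. norm (w t * Re (ip (f t) (g t))) \<le>
      norm ((w t * (norm (f t))\<^sup>2 + w t * (norm (g t))\<^sup>2) / 2)"
    by simp
qed

text \<open>
  After integration the hypothesis bounds \<open>\<parallel>f\<parallel>\<^sup>2 + mM \<parallel>g\<parallel>\<^sup>2\<close>, which is at least
  \<open>2 \<surd>(mM) \<parallel>f\<parallel> \<parallel>g\<parallel>\<close>.
\<close>

lemma reverse_Cauchy_Schwarz_weighted:
  assumes w: "\<And>t. t \<in> space N \<Longrightarrow> 0 \<le> w t"
    and f: "integrable N (\<lambda>t. w t * (norm (f t))\<^sup>2)"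
    and g: "integrable N (\<lambda>t. w t * (norm (g t))\<^sup>2)"
    and fg: "integrable N (\<lambda>t. w t * Re (ip (f t) (g t)))"
    and mM: "0 < m" "m \<le> M"
    and accretive: "AE t in N.
      (norm (f t))\<^sup>2 + m * M * (norm (g t))\<^sup>2 \<le> (m + M) * Re (ip (f t) (g t))"
  shows "2 * sqrt (m * M) / (m + M) * (sqrt (LINT t|N. w t * (norm (f t))\<^sup>2)
      * sqrt (LINT t|N. w t * (norm (g t))\<^sup>2)) \<le> (LINT t|N. w t * Re (ip (f t) (g t)))"
    (is "_ * (sqrt ?F * sqrt ?G) \<le> ?I")
proof -
  have nonneg: "0 \<le> ?F" "0 \<le> ?G"
    using w by (auto intro!: Bochner_Integration.integral_nonneg)
  have "0 \<le> (sqrt ?F - sqrt (m * M) * sqrt ?G)\<^sup>2"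
    by simp
  also have "\<dots> = ?F + m * M * ?G - 2 * sqrt (m * M) * (sqrt ?F * sqrt ?G)"
    using nonneg mM by (simp add: power2_diff power_mult_distrib)
  finally have "2 * sqrt (m * M) * (sqrt ?F * sqrt ?G) \<le> ?F + m * M * ?G"
    by simp
  also have "\<dots> = (LINT t|N. w t * (norm (f t))\<^sup>2 + m * M * (w t * (norm (g t))\<^sup>2))"
    using f g by simp
  also have "\<dots> \<le> (LINT t|N. (m + M) * (w t * Re (ip (f t) (g t))))"
  proof (rule integral_mono_AE)
    show "AE t in N. w t * (norm (f t))\<^sup>2 + m * M * (w t * (norm (g t))\<^sup>2) \<le>
        (m + M) * (w t * Re (ip (f t) (g t)))"
      using accretive AE_space
    proof eventually_elim
      case (elim t)
      then show ?case
        using mult_left_mono[OF elim(1) w[OF elim(2)]] by (simp add: algebra_simps)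
    qed
  qed (use f g fg in auto)
  also have "\<dots> = (m + M) * ?I"
    by simp
  finally show ?thesis
    using mM by (simp add: pos_divide_le_eq mult.commute)
qed

end

section \<open>Summation over all pairs\<close>

text \<open>
  Here \<open>B\<close> plays the role of the Gram matrix of vectors of norms \<open>r i\<close>. Both sides are double sums
  that agree on the diagonal, so \<open>c\<close> acts only on the off-diagonal entries.
\<close>

lemma gram_sum_lower_bound:
  fixes B :: "'i::linorder \<Rightarrow> 'i \<Rightarrow> real"
  assumes "finite I"
    and sym: "\<And>i j. i \<in> I \<Longrightarrow> j \<in> I \<Longrightarrow> B i j = B j i"
    and diag: "\<And>i. i \<in> I \<Longrightarrow> B i i = (r i)\<^sup>2"
    and lower: "\<And>i j. i \<in> I \<Longrightarrow> j \<in> I \<Longrightarrow> i < j \<Longrightarrow> c * (r i * r j) \<le> B i j"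
  shows "c * (\<Sum>i\<in>I. r i)\<^sup>2 + (1 - c) * (\<Sum>i\<in>I. (r i)\<^sup>2) \<le> (\<Sum>i\<in>I. \<Sum>j\<in>I. B i j)"
    and "c * (\<Sum>i\<in>I. r i)\<^sup>2 + (1 - c) * (\<Sum>i\<in>I. (r i)\<^sup>2) = (\<Sum>i\<in>I. \<Sum>j\<in>I. B i j) \<longleftrightarrow>
      (\<forall>i\<in>I. \<forall>j\<in>I. i < j \<longrightarrow> B i j = c * (r i * r j))"
proof -
  define d where "d i j = (if i = j then 0 else B i j - c * (r i * r j))" for i j
  have d_sym: "d i j = d j i" if "i \<in> I" "j \<in> I" for i j
    using sym[OF that] by (simp add: d_def mult.commute)
  have d_less: "0 \<le> d i j" if "i \<in> I" "j \<in> I" "i < j" for i j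
    using lower[OF that] that by (simp add: d_def)
  have d_nonneg: "0 \<le> d i j" if "i \<in> I" "j \<in> I" for i j
    using d_less[OF that] d_less[OF that(2,1)] d_sym[OF that]
    by (cases i j rule: linorder_cases) (auto simp: d_def)
  have "(\<Sum>i\<in>I. \<Sum>j\<in>I. d i j) =
      (\<Sum>i\<in>I. \<Sum>j\<in>I. B i j - c * (r i * r j) - (if i = j then (1 - c) * (r i)\<^sup>2 else 0))"
    by (intro sum.cong refl) (auto simp: d_def diag power2_eq_square algebra_simps)
  also have "\<dots> = (\<Sum>i\<in>I. \<Sum>j\<in>I. B i j)
      - ((\<Sum>i\<in>I. \<Sum>j\<in>I. c * (r i * r j)) + (1 - c) * (\<Sum>i\<in>I. (r i)\<^sup>2))"
    using \<open>finite I\<close> by (simp add: sum_subtractf sum_distrib_left)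
  also have "(\<Sum>i\<in>I. \<Sum>j\<in>I. c * (r i * r j)) = c * (\<Sum>i\<in>I. r i)\<^sup>2"
    unfolding power2_eq_square sum_product by (simp add: sum_distrib_left)
  finally have defect: "(\<Sum>i\<in>I. \<Sum>j\<in>I. d i j) = (\<Sum>i\<in>I. \<Sum>j\<in>I. B i j)
      - (c * (\<Sum>i\<in>I. r i)\<^sup>2 + (1 - c) * (\<Sum>i\<in>I. (r i)\<^sup>2))" .
  have "0 \<le> (\<Sum>i\<in>I. \<Sum>j\<in>I. d i j)"
    using d_nonneg by (intro sum_nonneg) auto
  with defect show "c * (\<Sum>i\<in>I. r i)\<^sup>2 + (1 - c) * (\<Sum>i\<in>I. (r i)\<^sup>2) \<le> (\<Sum>i\<in>I. \<Sum>j\<in>I. B i j)"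
    by simp
  have "(\<Sum>i\<in>I. \<Sum>j\<in>I. d i j) = 0 \<longleftrightarrow> (\<forall>i\<in>I. \<forall>j\<in>I. d i j = 0)"
    using \<open>finite I\<close> d_nonneg by (simp add: sum_nonneg_eq_0_iff sum_nonneg)
  also have "\<dots> \<longleftrightarrow> (\<forall>i\<in>I. \<forall>j\<in>I. i < j \<longrightarrow> d i j = 0)"
    using d_sym by (metis d_def linorder_less_linear)
  also have "\<dots> \<longleftrightarrow> (\<forall>i\<in>I. \<forall>j\<in>I. i < j \<longrightarrow> B i j = c * (r i * r j))"
    by (auto simp: d_def)
  finally show "c * (\<Sum>i\<in>I. r i)\<^sup>2 + (1 - c) * (\<Sum>i\<in>I. (r i)\<^sup>2) = (\<Sum>i\<in>I. \<Sum>j\<in>I. B i j) \<longleftrightarrow>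
      (\<forall>i\<in>I. \<forall>j\<in>I. i < j \<longrightarrow> B i j = c * (r i * r j))"
    using defect by auto
qed

section \<open>The reverse triangle inequality\<close>

theorem proposition5:
  fixes K :: "complex set"
    and scale :: "complex \<Rightarrow> 'h::{real_normed_vector,complete_space} \<Rightarrow> 'h"
    and ip :: "'h \<Rightarrow> 'h \<Rightarrow> complex"
    and a b m M :: real
    and \<eta> :: "real \<Rightarrow> real"
    and n :: nat
    and g :: "real \<Rightarrow> 'h"
    and f :: "nat \<Rightarrow> real \<Rightarrow> 'h"
  assumes hilbert: "hilbert_space_over K scale ip"
    and interval: "a \<le> b"
    and eta_nonneg: "\<forall>t\<in>{a..b}. \<eta> t \<ge> 0"
    and eta_integrable: "integrable (lebesgue_on {a..b}) \<eta>"
    and eta_integral: "(LINT t|lebesgue_on {a..b}. \<eta> t) = 1"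
    and n_pos: "n \<ge> 1"
    and g_in: "g \<in> L_weighted \<eta> a b"
    and g_norm: "(LINT t|lebesgue_on {a..b}. \<eta> t * (norm (g t))\<^sup>2) = 1"
    and f_in: "\<forall>i\<in>{1..n}. f i \<in> L_weighted \<eta> a b"
    and m_pos: "m > 0"
    and m_le_M: "m \<le> M"
  shows
    "(\<forall>t\<in>{a..b}. \<forall>i j. 1 \<le> i \<and> i < j \<and> j \<le> n \<longrightarrow>
        (Re (ip (M *\<^sub>R f j t - f i t) (f i t - m *\<^sub>R f j t)) \<ge> 0 \<longleftrightarrow>
         norm (f i t - ((m + M) / 2) *\<^sub>R f j t) \<le> 1 / 2 * (M - m) * norm (f j t))) \<and>
     ((AE t in lebesgue_on {a..b}. \<forall>i j. 1 \<le> i \<and> i < j \<and> j \<le> n \<longrightarrow>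
         Re (ip (M *\<^sub>R f j t - f i t) (f i t - m *\<^sub>R f j t)) \<ge> 0) \<or>
      (AE t in lebesgue_on {a..b}. \<forall>i j. 1 \<le> i \<and> i < j \<and> j \<le> n \<longrightarrow>
         norm (f i t - ((m + M) / 2) *\<^sub>R f j t) \<le> 1 / 2 * (M - m) * norm (f j t)) \<longrightarrow>
      2 * sqrt (m * M) / (m + M)
          * (\<Sum>i=1..n. sqrt (LINT t|lebesgue_on {a..b}. \<eta> t * (norm (f i t))\<^sup>2))\<^sup>2
        + (sqrt M - sqrt m)\<^sup>2 / (m + M)
          * (\<Sum>i=1..n. LINT t|lebesgue_on {a..b}. \<eta> t * (norm (f i t))\<^sup>2)
        \<le> (LINT t|lebesgue_on {a..b}. \<eta> t * (norm (\<Sum>i=1..n. f i t))\<^sup>2) \<and>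
      (2 * sqrt (m * M) / (m + M)
          * (\<Sum>i=1..n. sqrt (LINT t|lebesgue_on {a..b}. \<eta> t * (norm (f i t))\<^sup>2))\<^sup>2
        + (sqrt M - sqrt m)\<^sup>2 / (m + M)
          * (\<Sum>i=1..n. LINT t|lebesgue_on {a..b}. \<eta> t * (norm (f i t))\<^sup>2)
        = (LINT t|lebesgue_on {a..b}. \<eta> t * (norm (\<Sum>i=1..n. f i t))\<^sup>2) \<longleftrightarrow>
       (\<forall>i j. 1 \<le> i \<and> i < j \<and> j \<le> n \<longrightarrow>
          sqrt (LINT t|lebesgue_on {a..b}. \<eta> t * (norm (f i t))\<^sup>2)
            * sqrt (LINT t|lebesgue_on {a..b}. \<eta> t * (norm (f j t))\<^sup>2)
          = (M + m) / (2 * sqrt (m * M))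
            * (LINT t|lebesgue_on {a..b}. \<eta> t * Re (ip (f i t) (f j t))))))"
proof -
  interpret hilbert_space_over K scale ip
    by (fact hilbert)
  let ?N = "lebesgue_on {a..b}"
  let ?I = "\<lambda>i j. LINT t|?N. \<eta> t * Re (ip (f i t) (f j t))"
  let ?r = "\<lambda>i. sqrt (LINT t|?N. \<eta> t * (norm (f i t))\<^sup>2)"
  let ?c = "2 * sqrt (m * M) / (m + M)"
  have complete: "complete_measure ?N"
    by (rule complete_measure_lebesgue_on) simp
  have eta: "\<eta> \<in> borel_measurable ?N" "\<And>t. t \<in> space ?N \<Longrightarrow> 0 \<le> \<eta> t"
    using eta_integrable eta_nonneg by auto
  have f: "bochner_measurable ?N (f i)" "integrable ?N (\<lambda>t. \<eta> t * (norm (f i t))\<^sup>2)"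
    if "i \<in> {1..n}" for i
    using f_in that by (auto simp: L_weighted_def)
  have ff: "integrable ?N (\<lambda>t. \<eta> t * Re (ip (f i t) (f j t)))"
    if "i \<in> {1..n}" "j \<in> {1..n}" for i j
    using that by (intro integrable_weighted_Re_ip complete eta f)
  have equivalent: "0 \<le> Re (ip (M *\<^sub>R y - x) (x - m *\<^sub>R y)) \<longleftrightarrow>
      norm (x - ((m + M) / 2) *\<^sub>R y) \<le> 1 / 2 * (M - m) * norm y" for x y
    unfolding Re_ip_accretive norm_diff_midpoint_le_iff[OF m_le_M] ..
  have r_squared: "(?r i)\<^sup>2 = (LINT t|?N. \<eta> t * (norm (f i t))\<^sup>2)" for i
    using eta(2) by (intro real_sqrt_pow2 Bochner_Integration.integral_nonneg) auto
  have c_pos: "0 < ?c"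
    using m_pos m_le_M by simp
  have one_minus_c: "(sqrt M - sqrt m)\<^sup>2 / (m + M) = 1 - ?c"
    using m_pos m_le_M by (simp add: power2_diff real_sqrt_mult field_simps)
  have c_inverse: "(M + m) / (2 * sqrt (m * M)) = 1 / ?c"
    by simp
  have norm_sum: "(LINT t|?N. \<eta> t * (norm (\<Sum>i=1..n. f i t))\<^sup>2) = (\<Sum>i=1..n. \<Sum>j=1..n. ?I i j)"
  proof -
    have "(LINT t|?N. \<eta> t * (norm (\<Sum>i=1..n. f i t))\<^sup>2) =
        (LINT t|?N. (\<Sum>i=1..n. \<Sum>j=1..n. \<eta> t * Re (ip (f i t) (f j t))))"
      by (simp add: norm_sum_squared sum_distrib_left)
    also have "\<dots> = (\<Sum>i=1..n. LINT t|?N. (\<Sum>j=1..n. \<eta> t * Re (ip (f i t) (f j t))))"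
      by (intro Bochner_Integration.integral_sum Bochner_Integration.integrable_sum ff)
    also have "\<dots> = (\<Sum>i=1..n. \<Sum>j=1..n. ?I i j)"
      by (intro sum.cong refl Bochner_Integration.integral_sum ff)
    finally show ?thesis .
  qed
  have main: "?c * (\<Sum>i=1..n. ?r i)\<^sup>2
        + (sqrt M - sqrt m)\<^sup>2 / (m + M) * (\<Sum>i=1..n. LINT t|?N. \<eta> t * (norm (f i t))\<^sup>2)
        \<le> (LINT t|?N. \<eta> t * (norm (\<Sum>i=1..n. f i t))\<^sup>2) \<and>
      (?c * (\<Sum>i=1..n. ?r i)\<^sup>2
        + (sqrt M - sqrt m)\<^sup>2 / (m + M) * (\<Sum>i=1..n. LINT t|?N. \<eta> t * (norm (f i t))\<^sup>2)
        = (LINT t|?N. \<eta> t * (norm (\<Sum>i=1..n. f i t))\<^sup>2) \<longleftrightarrow>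
       (\<forall>i j. 1 \<le> i \<and> i < j \<and> j \<le> n \<longrightarrow> ?r i * ?r j = (M + m) / (2 * sqrt (m * M)) * ?I i j))"
    if accretive: "AE t in ?N. \<forall>i j. 1 \<le> i \<and> i < j \<and> j \<le> n \<longrightarrow>
         Re (ip (M *\<^sub>R f j t - f i t) (f i t - m *\<^sub>R f j t)) \<ge> 0"
  proof -
    have lower: "?c * (?r i * ?r j) \<le> ?I i j" if "i \<in> {1..n}" "j \<in> {1..n}" "i < j" for i j
    proof (rule reverse_Cauchy_Schwarz_weighted)
      show "AE t in ?N. (norm (f i t))\<^sup>2 + m * M * (norm (f j t))\<^sup>2 \<le>
          (m + M) * Re (ip (f i t) (f j t))"
        using accretive
      proof eventually_elim
        case (elim t)
        then have "Re (ip (M *\<^sub>R f j t - f i t) (f i t - m *\<^sub>R f j t)) \<ge> 0"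
          using that by simp
        then show ?case
          by (simp only: Re_ip_accretive)
      qed
    qed (use that eta(2) f ff m_pos m_le_M in auto)
    have sym: "?I i j = ?I j i" for i j
      by (simp add: Re_ip_commute[of "f i _"])
    have diag: "?I i i = (?r i)\<^sup>2" for i
      by (simp only: Re_ip_self r_squared)
    note bound = gram_sum_lower_bound[of "{1..n}" ?I ?r ?c,
        OF finite_atLeastAtMost sym diag lower, unfolded r_squared]
    have "(\<forall>i\<in>{1..n}. \<forall>j\<in>{1..n}. i < j \<longrightarrow> ?I i j = ?c * (?r i * ?r j)) \<longleftrightarrow>
        (\<forall>i j. 1 \<le> i \<and> i < j \<and> j \<le> n \<longrightarrow> ?I i j = ?c * (?r i * ?r j))"
      by auto
    also have "\<dots> \<longleftrightarrow>
        (\<forall>i j. 1 \<le> i \<and> i < j \<and> j \<le> n \<longrightarrow> ?r i * ?r j = (M + m) / (2 * sqrt (m * M)) * ?I i j)"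
    proof -
      have "u = c * v \<longleftrightarrow> v = 1 / c * u" if "0 < c" for u v c :: real
        using that by (auto simp: field_simps)
      from this[OF c_pos] show ?thesis
        by (simp only: c_inverse)
    qed
    finally have pairs: "(\<forall>i\<in>{1..n}. \<forall>j\<in>{1..n}. i < j \<longrightarrow> ?I i j = ?c * (?r i * ?r j)) \<longleftrightarrow>
        (\<forall>i j. 1 \<le> i \<and> i < j \<and> j \<le> n \<longrightarrow> ?r i * ?r j = (M + m) / (2 * sqrt (m * M)) * ?I i j)" .
    show ?thesis
      unfolding norm_sum one_minus_c by (intro conjI bound(1) trans[OF bound(2) pairs])
  qed
  show ?thesis
  proof (rule conjI)
    show "\<forall>t\<in>{a..b}. \<forall>i j. 1 \<le> i \<and> i < j \<and> j \<le> n \<longrightarrow>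
        (Re (ip (M *\<^sub>R f j t - f i t) (f i t - m *\<^sub>R f j t)) \<ge> 0 \<longleftrightarrow>
         norm (f i t - ((m + M) / 2) *\<^sub>R f j t) \<le> 1 / 2 * (M - m) * norm (f j t))"
      by (intro ballI allI impI equivalent)
  qed (rule impI, rule main, simp only: equivalent disj_absorb)
qed

end
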